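(* The class of mid rings is strictly between the class of reduced mp-rings and the class of mp-rings. That is: every reduced mp-ring is a mid ring, and there exists a mid ring that is not a reduced mp-ring; every mid ring is an mp-ring, and there exists an mp-ring that is not a mid ring.
   Context: All rings are commutative with identity. $\mathfrak{N}$ denotes the nil-radical of $R$, and $\mathrm{Ann}(a)=\{r\in R: ra=0\}$. An ideal $I$ of $R$ is called N-pure if for every $a\in I$ there exists $b\in I$ such that $a(1-b)\in\mathfrak{N}$. A ring $R$ is called a mid ring if for every $a\in R$, $\mathrm{Ann}(a)$ is an N-pure ideal. A ring $R$ is an mp-ring if each prime ideal of $R$ contains a unique minimal prime ideal of $R$. *)

theory Defs
  imports "HOL-Algebra.Algebra"
begin

definition nilradical :: "('a, 'm) ring_scheme \<Rightarrow> 'a set" where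
  "nilradical R = {x \<in> carrier R. \<exists>n::nat. x [^]\<^bsub>R\<^esub> n = \<zero>\<^bsub>R\<^esub>}"

definition annihilator :: "('a, 'm) ring_scheme \<Rightarrow> 'a \<Rightarrow> 'a set" where
  "annihilator R a = {r \<in> carrier R. r \<otimes>\<^bsub>R\<^esub> a = \<zero>\<^bsub>R\<^esub>}"

definition N_pure :: "('a, 'm) ring_scheme \<Rightarrow> 'a set \<Rightarrow> bool" where
  "N_pure R I \<longleftrightarrow> ideal I R \<and>
     (\<forall>a\<in>I. \<exists>b\<in>I. a \<otimes>\<^bsub>R\<^esub> (\<one>\<^bsub>R\<^esub> \<ominus>\<^bsub>R\<^esub> b) \<in> nilradical R)"

definition minimal_prime :: "('a, 'm) ring_scheme \<Rightarrow> 'a set \<Rightarrow> bool" where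
  "minimal_prime R P \<longleftrightarrow> primeideal P R \<and>
     (\<forall>Q. primeideal Q R \<and> Q \<subseteq> P \<longrightarrow> Q = P)"

definition reduced_ring :: "('a, 'm) ring_scheme \<Rightarrow> bool" where
  "reduced_ring R \<longleftrightarrow> cring R \<and> nilradical R = {\<zero>\<^bsub>R\<^esub>}"

definition mid_ring :: "('a, 'm) ring_scheme \<Rightarrow> bool" where
  "mid_ring R \<longleftrightarrow> cring R \<and> (\<forall>a\<in>carrier R. N_pure R (annihilator R a))"

definition mp_ring :: "('a, 'm) ring_scheme \<Rightarrow> bool" where
  "mp_ring R \<longleftrightarrow> cring R \<and>
     (\<forall>P. primeideal P R \<longrightarrow> (\<exists>!Q. minimal_prime R Q \<and> Q \<subseteq> P))"

end

theory Submission
  imports Defs "HOL-Number_Theory.Residues"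
begin

text \<open>
  By Krull's prime avoidance argument, an element \<open>x\<close> lies in every prime contained in a given
  prime \<open>P\<close> iff \<open>s x\<close> is nilpotent for some \<open>s \<notin> P\<close>. In a mid ring this criterion shows that the
  intersection of all primes inside \<open>P\<close> is itself prime, hence the unique minimal prime below \<open>P\<close>.
  Conversely, let the ring be reduced and mp, with \<open>c a = 0\<close>. The minimal prime inside a prime
  \<open>P \<supseteq> Ann(a) + Ann(c)\<close> would contain \<open>a\<close> or \<open>c\<close>, and the criterion would put an element outside
  \<open>P\<close> into \<open>Ann(a)\<close> or \<open>Ann(c)\<close>. So \<open>Ann(a) + Ann(c) = R\<close>, which makes \<open>Ann(a)\<close> pure.
  The ring \<open>\<int>/4\<close> is mid but not reduced. The trivial extension of \<open>\<int>\<close> by the module \<open>\<int>/2\<close> has a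
  prime nilradical but a zero divisor \<open>(2, 0)\<close> that violates purity of \<open>Ann (0, 1)\<close>.
\<close>

section \<open>Prime ideals\<close>

lemma (in abelian_group) add_minus_cancel:
  assumes "x \<in> carrier G" "y \<in> carrier G"
  shows "x \<oplus> (y \<ominus> x) = y"
  using assms by (simp add: minus_eq a_lcomm[of x y] r_neg)

lemma (in ring) ideal_Union_chain:
  assumes "\<C> \<noteq> {}" and ideals: "\<And>J. J \<in> \<C> \<Longrightarrow> ideal J R"
    and chain: "\<And>I J. I \<in> \<C> \<Longrightarrow> J \<in> \<C> \<Longrightarrow> I \<subseteq> J \<or> J \<subseteq> I"
  shows "ideal (\<Union>\<C>) R"
proof (rule idealI[OF ring_axioms])
  have subgroups: "additive_subgroup J R" if "J \<in> \<C>" for J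
    using ideals[OF that] by (rule ideal.axioms)
  show "subgroup (\<Union>\<C>) (add_monoid R)"
  proof (rule add.subgroupI)
    show "\<Union>\<C> \<subseteq> carrier R"
      using subgroups additive_subgroup.a_subset by blast
    obtain J where "J \<in> \<C>"
      using assms(1) by blast
    then show "\<Union>\<C> \<noteq> {}"
      using additive_subgroup.zero_closed[OF subgroups] by blast
    show "\<ominus> x \<in> \<Union>\<C>" if x: "x \<in> \<Union>\<C>" for x
    proof -
      obtain J where "J \<in> \<C>" "x \<in> J"
        using x by blast
      then show ?thesis
        using additive_subgroup.a_inv_closed[OF subgroups] by blast
    qed
    show "x \<oplus> y \<in> \<Union>\<C>" if xy: "x \<in> \<Union>\<C>" "y \<in> \<Union>\<C>" for x y
    proof -
      obtain J where "J \<in> \<C>" "x \<in> J" "y \<in> J"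
        using xy chain by blast
      then show ?thesis
        using additive_subgroup.a_closed[OF subgroups] by blast
    qed
  qed
  fix a x assume "a \<in> \<Union>\<C>" and x: "x \<in> carrier R"
  then obtain J where J: "J \<in> \<C>" "a \<in> J"
    by blast
  show "x \<otimes> a \<in> \<Union>\<C>" "a \<otimes> x \<in> \<Union>\<C>"
    using J ideal.I_l_closed[OF ideals J(2) x] ideal.I_r_closed[OF ideals J(2) x] by blast+
qed

lemma (in cring) exists_primeideal_disjoint:
  assumes I: "ideal I R" and S: "submonoid S R" and disjoint: "I \<inter> S = {}"
  obtains P where "primeideal P R" "I \<subseteq> P" "P \<inter> S = {}"
proof -
  define \<A> where "\<A> = {J. ideal J R \<and> I \<subseteq> J \<and> J \<inter> S = {}}"
  have "\<exists>M\<in>\<A>. \<forall>J\<in>\<A>. M \<subseteq> J \<longrightarrow> J = M"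
  proof (rule subset_Zorn_nonempty)
    show "\<A> \<noteq> {}"
      using I disjoint by (auto simp: \<A>_def)
    fix \<C> assume "\<C> \<noteq> {}" and chain: "subset.chain \<A> \<C>"
    have "\<C> \<subseteq> \<A>" and "\<And>I J. I \<in> \<C> \<Longrightarrow> J \<in> \<C> \<Longrightarrow> I \<subseteq> J \<or> J \<subseteq> I"
      using chain by (auto simp: subset_chain_def)
    moreover from this have "ideal (\<Union>\<C>) R"
      by (intro ideal_Union_chain \<open>\<C> \<noteq> {}\<close>) (auto simp: \<A>_def)
    ultimately show "\<Union>\<C> \<in> \<A>"
      using \<open>\<C> \<noteq> {}\<close> by (auto simp: \<A>_def)
  qed
  then obtain M where "M \<in> \<A>" and max: "\<And>J. J \<in> \<A> \<Longrightarrow> M \<subseteq> J \<Longrightarrow> J = M"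
    by blast
  then have M: "ideal M R" "I \<subseteq> M" "M \<inter> S = {}"
    by (simp_all add: \<A>_def)
  have maximal: "J = M" if "ideal J R" "M \<subseteq> J" "J \<inter> S = {}" for J
    using that M(2) by (intro max) (auto simp: \<A>_def)
  interpret M: ideal M R by fact
  have meets: "\<exists>m\<in>M. \<exists>x\<in>carrier R. m \<oplus> x \<otimes> a \<in> S" if a: "a \<in> carrier R" "a \<notin> M" for a
  proof -
    have J: "ideal (M <+>\<^bsub>R\<^esub> PIdl a) R"
      using add_ideals[OF M(1) cgenideal_ideal[OF a(1)]] .
    have "m \<in> M <+>\<^bsub>R\<^esub> PIdl a" if "m \<in> M" for m
    proof -
      have "m = m \<oplus> \<zero> \<otimes> a"
        using that a M.Icarr by simp
      then show ?thesis
        using that unfolding set_add_def' cgenideal_def by blast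
    qed
    moreover have "a \<in> M <+>\<^bsub>R\<^esub> PIdl a"
    proof -
      have "a = \<zero> \<oplus> \<one> \<otimes> a"
        using a by simp
      then show ?thesis
        using M.zero_closed unfolding set_add_def' cgenideal_def by blast
    qed
    ultimately have "(M <+>\<^bsub>R\<^esub> PIdl a) \<inter> S \<noteq> {}"
      using maximal[OF J] a(2) by blast
    then show ?thesis
      unfolding set_add_def' cgenideal_def by blast
  qed
  have "primeideal M R"
  proof (rule primeidealI[OF M(1) is_cring])
    show "carrier R \<noteq> M"
      using M(3) submonoid.one_closed[OF S] by auto
    fix a b assume ab: "a \<in> carrier R" "b \<in> carrier R" "a \<otimes> b \<in> M"
    show "a \<in> M \<or> b \<in> M"
    proof (rule ccontr)
      assume "\<not> (a \<in> M \<or> b \<in> M)"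
      then obtain m x n y where *: "m \<in> M" "x \<in> carrier R" "m \<oplus> x \<otimes> a \<in> S"
        "n \<in> M" "y \<in> carrier R" "n \<oplus> y \<otimes> b \<in> S"
        using meets ab by meson
      have "(m \<oplus> x \<otimes> a) \<otimes> (n \<oplus> y \<otimes> b)
        = m \<otimes> (n \<oplus> y \<otimes> b) \<oplus> ((x \<otimes> a) \<otimes> n \<oplus> (x \<otimes> y) \<otimes> (a \<otimes> b))"
        using * ab M.Icarr by (simp add: l_distr r_distr m_ac a_ac)
      also have "\<dots> \<in> M"
      proof (intro M.a_closed)
        show "m \<otimes> (n \<oplus> y \<otimes> b) \<in> M"
          using * ab M.Icarr by (intro M.I_r_closed) auto
        show "(x \<otimes> a) \<otimes> n \<in> M" "(x \<otimes> y) \<otimes> (a \<otimes> b) \<in> M"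
          using * ab by (auto intro: M.I_l_closed)
      qed
      finally show False
        using submonoid.m_closed[OF S *(3) *(6)] M(3) by blast
    qed
  qed
  then show ?thesis
    using that M by blast
qed

lemma (in primeideal) one_notin: "\<one> \<notin> I"
  using one_imp_carrier I_notcarr by blast

lemma (in primeideal) nat_pow_in_iff:
  assumes "x \<in> carrier R"
  shows "x [^] (n::nat) \<in> I \<longleftrightarrow> n \<noteq> 0 \<and> x \<in> I"
proof (induction n)
  case (Suc n)
  have "x [^] n \<otimes> x \<in> I \<longleftrightarrow> x \<in> I"
    using I_prime[of "x [^] n" x] I_l_closed[of x "x [^] n"] assms Suc by auto
  then show ?case by simp
qed (simp add: one_notin)

lemma (in primeideal) nilradical_subset: "nilradical R \<subseteq> I"
proof
  fix x assume "x \<in> nilradical R"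
  then obtain n :: nat where "x \<in> carrier R" "x [^] n = \<zero>"
    by (auto simp: nilradical_def)
  then show "x \<in> I"
    using nat_pow_in_iff[of x n] zero_closed by simp
qed

lemma (in cring) local_nilpotentI:
  assumes P: "primeideal P R" and x: "x \<in> carrier R"
    and below: "\<And>Q. primeideal Q R \<Longrightarrow> Q \<subseteq> P \<Longrightarrow> x \<in> Q"
  obtains s where "s \<in> carrier R" "s \<notin> P" "s \<otimes> x \<in> nilradical R"
proof -
  interpret P: primeideal P R by fact
  define S where "S = {s \<otimes> x [^] n | s (n::nat). s \<in> carrier R \<and> s \<notin> P}"
  have "submonoid S R"
  proof
    show "S \<subseteq> carrier R"
      using x by (auto simp: S_def)
    have "\<one> = \<one> \<otimes> x [^] (0::nat)"
      by simp
    then show "\<one> \<in> S"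
      using P.one_notin unfolding S_def by blast
    fix u v assume "u \<in> S" "v \<in> S"
    then obtain s t and m n :: nat where st: "s \<in> carrier R" "s \<notin> P" "t \<in> carrier R" "t \<notin> P"
      and "u = s \<otimes> x [^] m" "v = t \<otimes> x [^] n"
      by (auto simp: S_def)
    then have "u \<otimes> v = (s \<otimes> t) \<otimes> x [^] (m + n)"
      using x by (simp add: nat_pow_mult[symmetric] m_ac)
    moreover have "s \<otimes> t \<notin> P"
      using st P.I_prime by blast
    ultimately show "u \<otimes> v \<in> S"
      using st unfolding S_def by blast
  qed
  moreover have "\<not> (\<exists>Q. primeideal Q R \<and> Q \<inter> S = {})"
  proof
    assume "\<exists>Q. primeideal Q R \<and> Q \<inter> S = {}"
    then obtain Q where Q: "primeideal Q R" "Q \<inter> S = {}" by blast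
    have "s \<in> S" if "s \<in> carrier R" "s \<notin> P" for s
    proof -
      have "s = s \<otimes> x [^] (0::nat)"
        using that by simp
      then show ?thesis
        using that unfolding S_def by blast
    qed
    then have "Q \<subseteq> P"
      using Q(2) ideal.Icarr[OF primeideal.axioms(1)[OF Q(1)]] by blast
    moreover have "x \<in> S"
    proof -
      have "x = \<one> \<otimes> x [^] (1::nat)"
        using x by simp
      then show ?thesis
        using P.one_notin unfolding S_def by blast
    qed
    ultimately show False
      using below Q by blast
  qed
  ultimately have "\<zero> \<in> S"
    using exists_primeideal_disjoint[OF zeroideal] by (metis Int_insert_left_if0 Int_empty_left)
  then obtain s and n :: nat where s: "s \<in> carrier R" "s \<notin> P" "s \<otimes> x [^] n = \<zero>"
    by (auto simp: S_def)
  have "(s \<otimes> x) [^] Suc n = (s [^] n \<otimes> x) \<otimes> (s \<otimes> x [^] n)"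
    using s(1) x by (simp add: nat_pow_distrib m_ac)
  also have "\<dots> = \<zero>"
    using s x by simp
  finally have "(s \<otimes> x) [^] Suc n = \<zero>" .
  then have "s \<otimes> x \<in> nilradical R"
    using s x unfolding nilradical_def by blast
  with s that show ?thesis by blast
qed

lemma least_prime_imp_unique_minimal_prime:
  assumes "primeideal Q R" "Q \<subseteq> P" "\<And>Q'. primeideal Q' R \<Longrightarrow> Q' \<subseteq> P \<Longrightarrow> Q \<subseteq> Q'"
  shows "\<exists>!Q. minimal_prime R Q \<and> Q \<subseteq> P"
proof
  show "minimal_prime R Q \<and> Q \<subseteq> P"
    using assms by (auto simp: minimal_prime_def)
  show "Q' = Q" if "minimal_prime R Q' \<and> Q' \<subseteq> P" for Q'
    using that assms unfolding minimal_prime_def by metis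
qed

lemma mp_ring_minimal_prime_subset:
  assumes "mp_ring R" "primeideal P R" "minimal_prime R Q" "Q \<subseteq> P" "primeideal Q' R" "Q' \<subseteq> P"
  shows "Q \<subseteq> Q'"
proof -
  obtain Q'' where "minimal_prime R Q''" "Q'' \<subseteq> Q'"
    using assms unfolding mp_ring_def by blast
  moreover have "\<exists>!Q. minimal_prime R Q \<and> Q \<subseteq> P"
    using assms(1,2) by (simp add: mp_ring_def)
  ultimately have "Q'' = Q"
    using assms(3,4,6) by blast
  with \<open>Q'' \<subseteq> Q'\<close> show ?thesis
    by simp
qed

section \<open>Mid rings and mp-rings\<close>

lemma (in cring) annihilator_ideal:
  assumes a: "a \<in> carrier R"
  shows "ideal (annihilator R a) R"
proof (rule idealI[OF ring_axioms])
  show "subgroup (annihilator R a) (add_monoid R)"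
  proof (rule add.subgroupI)
    show "annihilator R a \<noteq> {}"
      using a l_null unfolding annihilator_def by blast
  qed (use a in \<open>auto simp: annihilator_def l_distr l_minus\<close>)
  fix r x assume r: "r \<in> annihilator R a" and x: "x \<in> carrier R"
  then show "x \<otimes> r \<in> annihilator R a"
    using a by (auto simp: annihilator_def m_assoc)
  then show "r \<otimes> x \<in> annihilator R a"
    using r x by (simp add: annihilator_def m_comm[of r x])
qed

theorem reduced_mp_ring_imp_mid_ring:
  fixes R (structure)
  assumes reduced: "reduced_ring R" and mp: "mp_ring R"
  shows "mid_ring R"
proof -
  interpret cring R
    using mp by (simp add: mp_ring_def)
  have escape: "\<exists>s\<in>annihilator R x. s \<notin> P"
    if P: "primeideal P R" and Q: "minimal_prime R Q" "Q \<subseteq> P" and x: "x \<in> Q" for P Q x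
  proof -
    have xR: "x \<in> carrier R"
      using Q(1) x unfolding minimal_prime_def by (meson ideal.Icarr primeideal.axioms(1))
    obtain s where "s \<in> carrier R" "s \<notin> P" "s \<otimes> x \<in> nilradical R"
      using local_nilpotentI[OF P xR] mp_ring_minimal_prime_subset[OF mp P Q] x by blast
    then show ?thesis
      using reduced by (auto simp: reduced_ring_def annihilator_def)
  qed
  have "\<exists>b\<in>annihilator R a. c \<otimes> (\<one> \<ominus> b) \<in> nilradical R"
    if a: "a \<in> carrier R" and c: "c \<in> annihilator R a" for a c
  proof -
    have cR: "c \<in> carrier R" and ca: "c \<otimes> a = \<zero>"
      using c by (auto simp: annihilator_def)
    define J where "J = annihilator R a <+>\<^bsub>R\<^esub> annihilator R c"
    interpret A: ideal "annihilator R a" R using a by (rule annihilator_ideal)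
    interpret C: ideal "annihilator R c" R using cR by (rule annihilator_ideal)
    have J: "ideal J R"
      unfolding J_def by (intro add_ideals A.is_ideal C.is_ideal)
    have AJ: "annihilator R a \<subseteq> J"
    proof
      fix r assume "r \<in> annihilator R a"
      moreover from this have "r = r \<oplus> \<zero>" using A.Icarr by simp
      ultimately show "r \<in> J" using C.zero_closed unfolding J_def set_add_def' by blast
    qed
    have CJ: "annihilator R c \<subseteq> J"
    proof
      fix r assume "r \<in> annihilator R c"
      moreover from this have "r = \<zero> \<oplus> r" using C.Icarr by simp
      ultimately show "r \<in> J" using A.zero_closed unfolding J_def set_add_def' by blast
    qed
    have "\<one> \<in> J"
    proof (rule ccontr)
      assume "\<one> \<notin> J"
      moreover have "submonoid {\<one>} R"
        by unfold_locales auto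
      ultimately obtain P where P: "primeideal P R" "J \<subseteq> P"
        using exists_primeideal_disjoint[OF J, of "{\<one>}"] by blast
      obtain Q where Q: "minimal_prime R Q" "Q \<subseteq> P"
        using mp P unfolding mp_ring_def by blast
      interpret Q: primeideal Q R
        using Q by (simp add: minimal_prime_def)
      have "c \<in> Q \<or> a \<in> Q"
        using Q.I_prime[OF cR a] ca Q.zero_closed by simp
      then show False
        using escape[OF P(1) Q] AJ CJ P(2) by blast
    qed
    then obtain b d where b: "b \<in> annihilator R a" and d: "d \<in> annihilator R c"
      and bd: "\<one> = b \<oplus> d"
      unfolding J_def set_add_def' by blast
    have "c \<otimes> d = \<zero>"
      using d m_comm[OF cR C.Icarr[OF d]] unfolding annihilator_def by simp
    moreover have "\<one> \<ominus> b = d"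
      unfolding bd using A.Icarr[OF b] C.Icarr[OF d]
      by (simp add: minus_eq a_comm[of b d] a_assoc r_neg)
    ultimately have "c \<otimes> (\<one> \<ominus> b) = \<zero>"
      by simp
    then show ?thesis
      using b reduced by (auto simp: reduced_ring_def)
  qed
  then show ?thesis
    using is_cring annihilator_ideal by (auto simp: mid_ring_def N_pure_def)
qed

theorem mid_ring_imp_mp_ring:
  fixes R (structure)
  assumes mid: "mid_ring R"
  shows "mp_ring R"
proof -
  interpret cring R
    using mid by (simp add: mid_ring_def)
  have "\<exists>!Q. minimal_prime R Q \<and> Q \<subseteq> P" if P: "primeideal P R" for P
  proof (rule least_prime_imp_unique_minimal_prime)
    interpret P: primeideal P R by fact
    define Q where "Q = \<Inter>{Q. primeideal Q R \<and> Q \<subseteq> P}"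
    show "Q \<subseteq> P" and "\<And>Q'. primeideal Q' R \<Longrightarrow> Q' \<subseteq> P \<Longrightarrow> Q \<subseteq> Q'"
      using P unfolding Q_def by blast+
    show "primeideal Q R"
    proof (rule primeidealI[OF _ is_cring])
      show "ideal Q R"
        unfolding Q_def using P by (intro i_Intersect) (auto simp: primeideal_def)
      show "carrier R \<noteq> Q"
        using \<open>Q \<subseteq> P\<close> P.one_notin by blast
      fix x y assume x: "x \<in> carrier R" and y: "y \<in> carrier R" and xy: "x \<otimes> y \<in> Q"
      show "x \<in> Q \<or> y \<in> Q"
      proof (rule ccontr)
        assume "\<not> (x \<in> Q \<or> y \<in> Q)"
        then obtain Q1 Q2 where Q1: "primeideal Q1 R" "Q1 \<subseteq> P" "x \<notin> Q1"
          and Q2: "primeideal Q2 R" "Q2 \<subseteq> P" "y \<notin> Q2"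
          unfolding Q_def by blast
        interpret Q1: primeideal Q1 R by fact
        interpret Q2: primeideal Q2 R by fact
        obtain s where s: "s \<in> carrier R" "s \<notin> P" "s \<otimes> (x \<otimes> y) \<in> nilradical R"
          using local_nilpotentI[OF P m_closed[OF x y]] xy unfolding Q_def by blast
        then obtain n :: nat where "(s \<otimes> (x \<otimes> y)) [^] n = \<zero>"
          by (auto simp: nilradical_def)
        then have "(s \<otimes> x) [^] n \<otimes> y [^] n = \<zero>"
          using s x y by (simp add: nat_pow_distrib m_assoc)
        then have "(s \<otimes> x) [^] n \<in> annihilator R (y [^] n)"
          using s x by (simp add: annihilator_def)
        then obtain b where b: "b \<in> annihilator R (y [^] n)"
          and nil: "(s \<otimes> x) [^] n \<otimes> (\<one> \<ominus> b) \<in> nilradical R"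
          using mid y unfolding mid_ring_def N_pure_def by (meson nat_pow_closed)
        have bR: "b \<in> carrier R" and "b \<otimes> y [^] n \<in> Q2"
          using b by (auto simp: annihilator_def)
        then have "b \<in> Q2"
          using Q2.I_prime y Q2.nat_pow_in_iff Q2(3) by blast
        moreover have "\<one> \<ominus> b \<in> Q1"
        proof -
          have "s \<otimes> x \<notin> Q1"
            using Q1 s x Q1.I_prime by blast
          then show ?thesis
            using Q1.I_prime[OF _ _ subsetD[OF Q1.nilradical_subset nil]]
              Q1.nat_pow_in_iff[of "s \<otimes> x" n] s x bR by simp
        qed
        ultimately have "b \<oplus> (\<one> \<ominus> b) \<in> P"
          using Q1(2) Q2(2) P.a_closed by blast
        also have "b \<oplus> (\<one> \<ominus> b) = \<one>"
          using bR by (simp add: add_minus_cancel)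
        finally show False
          using P.one_notin by simp
      qed
    qed
  qed
  then show ?thesis
    using is_cring by (simp add: mp_ring_def)
qed

section \<open>Separating examples\<close>

lemma mid_ring_residue_ring_4: "mid_ring (residue_ring 4)" (is "mid_ring ?R")
  and not_reduced_residue_ring_4: "\<not> reduced_ring (residue_ring 4)"
proof -
  interpret residues 4 ?R
    by unfold_locales auto
  have carrier: "carrier ?R = {0, 1, 2, 3}"
    by (auto simp: res_carrier_eq)
  have "x [^]\<^bsub>?R\<^esub> (2::nat) = \<zero>\<^bsub>?R\<^esub>" if "x \<in> {0, 2}" for x
    using that by (auto simp: numeral_2_eq_2 res_mult_eq res_zero_eq res_one_eq)
  then have nil: "x \<in> nilradical ?R" if "x \<in> {0, 2}" for x
    using that unfolding nilradical_def carrier by blast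
  then have "2 \<in> nilradical ?R" by simp
  then show "\<not> reduced_ring ?R"
    by (auto simp: reduced_ring_def res_zero_eq)
  have "\<exists>b\<in>annihilator ?R a. c \<otimes>\<^bsub>?R\<^esub> (\<one>\<^bsub>?R\<^esub> \<ominus>\<^bsub>?R\<^esub> b) \<in> nilradical ?R"
    if a: "a \<in> carrier ?R" and c: "c \<in> annihilator ?R a" for a c
  proof (cases "c \<in> {0, 2}")
    case True
    show ?thesis
    proof (rule bexI)
      show "c \<otimes>\<^bsub>?R\<^esub> (\<one>\<^bsub>?R\<^esub> \<ominus>\<^bsub>?R\<^esub> 0) \<in> nilradical ?R"
        using True by (intro nil) (auto simp: a_minus_def res_neg_eq res_add_eq res_mult_eq res_one_eq)
      show "0 \<in> annihilator ?R a"
        by (auto simp: annihilator_def carrier res_mult_eq res_zero_eq)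
    qed
  next
    case False
    then have "a = 0"
      using a c by (auto simp: annihilator_def carrier res_mult_eq res_zero_eq)
    show ?thesis
    proof (rule bexI)
      show "c \<otimes>\<^bsub>?R\<^esub> (\<one>\<^bsub>?R\<^esub> \<ominus>\<^bsub>?R\<^esub> 1) \<in> nilradical ?R"
        by (intro nil) (auto simp: a_minus_def res_neg_eq res_add_eq res_mult_eq res_one_eq)
      show "1 \<in> annihilator ?R a"
        by (auto simp: \<open>a = 0\<close> annihilator_def carrier res_mult_eq res_zero_eq)
    qed
  qed
  then show "mid_ring ?R"
    using cring cring.annihilator_ideal by (auto simp: mid_ring_def N_pure_def)
qed

text \<open>The pair \<open>(n, e)\<close> in the trivial extension of \<open>\<int>\<close> by \<open>\<int>/2\<close>, whose product is
  \<open>(n, e) (m, f) = (n m, n f + m e)\<close>, is encoded as the integer \<open>2 n + e\<close> with \<open>e \<in> {0, 1}\<close>.\<close>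

definition trivial_extension :: "int ring" where
  "trivial_extension = \<lparr>carrier = UNIV,
     monoid.mult = \<lambda>k l. 2 * ((k div 2) * (l div 2)) + ((k div 2) * l + (l div 2) * k) mod 2,
     monoid.one = 2,
     ring.zero = 0,
     ring.add = \<lambda>k l. 2 * (k div 2 + l div 2) + (k + l) mod 2\<rparr>"

context
  fixes T (structure)
  defines "T \<equiv> trivial_extension"
begin

lemma trivial_extension_simps:
  "carrier T = UNIV" "\<one> = 2" "\<zero> = 0"
  "(k \<oplus> l) div 2 = k div 2 + l div 2"
  "(k \<otimes> l) div 2 = (k div 2) * (l div 2)"
  "even (k \<oplus> l) \<longleftrightarrow> even (k + l)"
  "even (k \<otimes> l) \<longleftrightarrow> even ((k div 2) * l + (l div 2) * k)"
  by (simp_all add: T_def trivial_extension_def)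

lemma int_eq_div_2_even:
  assumes "k div 2 = l div 2" "even k \<longleftrightarrow> even l"
  shows "k = (l::int)"
  using assms by presburger

lemma cring_trivial_extension: "cring T"
proof (rule cringI)
  show "abelian_group T"
  proof (rule abelian_groupI)
    show "(x \<oplus> y) \<oplus> z = x \<oplus> (y \<oplus> z)" for x y z
      by (rule int_eq_div_2_even) (auto simp: trivial_extension_simps)
    show "x \<oplus> y = y \<oplus> x" for x y
      by (rule int_eq_div_2_even) (auto simp: trivial_extension_simps)
    show "\<zero> \<oplus> x = x" for x
      by (rule int_eq_div_2_even) (auto simp: trivial_extension_simps)
    show "\<exists>y\<in>carrier T. y \<oplus> x = \<zero>" for x
    proof
      show "2 * (- (x div 2)) + x mod 2 \<oplus> x = \<zero>"
        by (rule int_eq_div_2_even) (auto simp: trivial_extension_simps)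
    qed (simp add: trivial_extension_simps)
  qed (simp_all add: trivial_extension_simps)
  show "comm_monoid T"
  proof (rule comm_monoidI)
    show "(x \<otimes> y) \<otimes> z = x \<otimes> (y \<otimes> z)" for x y z
      by (rule int_eq_div_2_even) (auto simp: trivial_extension_simps)
    show "\<one> \<otimes> x = x" for x
      by (rule int_eq_div_2_even) (auto simp: trivial_extension_simps)
    show "x \<otimes> y = y \<otimes> x" for x y
      by (rule int_eq_div_2_even) (auto simp: trivial_extension_simps)
  qed (simp_all add: trivial_extension_simps)
  show "(x \<oplus> y) \<otimes> z = x \<otimes> z \<oplus> y \<otimes> z" for x y z
    by (rule int_eq_div_2_even) (auto simp: trivial_extension_simps distrib_right)
qed

lemma primeideal_trivial_extension: "primeideal {k. k div 2 = 0} T"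
proof -
  interpret cring T by (rule cring_trivial_extension)
  show ?thesis
  proof (rule primeidealI[OF idealI[OF ring_axioms] is_cring])
    show "subgroup {k. k div 2 = 0} (add_monoid T)"
    proof (rule add.subgroupI)
      fix k :: int assume k: "k \<in> {k. k div 2 = 0}"
      have "(k \<oplus> \<ominus> k) div 2 = 0"
        by (simp add: r_neg trivial_extension_simps)
      then show "\<ominus> k \<in> {k. k div 2 = 0}"
        using k by (simp add: trivial_extension_simps)
    qed (auto simp: trivial_extension_simps intro: exI[of _ 0])
    show "carrier T \<noteq> {k. k div 2 = 0}"
      by (auto simp: trivial_extension_simps set_eq_iff intro: exI[of _ 2])
  qed (auto simp: trivial_extension_simps)
qed

lemma mp_ring_trivial_extension: "mp_ring T"
proof -
  have least: "{k. k div 2 = 0} \<subseteq> P" if "primeideal P T" for P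
  proof -
    interpret primeideal P T by fact
    have "1 \<otimes> 1 = 0"
      by (rule int_eq_div_2_even) (auto simp: trivial_extension_simps)
    moreover have "0 \<in> P"
      using additive_subgroup.zero_closed[OF is_additive_subgroup]
      unfolding trivial_extension_simps(3) .
    ultimately have "{0, 1} \<subseteq> P"
      using I_prime[of 1 1] by (auto simp: trivial_extension_simps(1))
    moreover have "k \<in> {0, 1}" if "k div 2 = 0" for k :: int
      using that by auto
    ultimately show ?thesis
      by blast
  qed
  have "\<exists>!Q. minimal_prime T Q \<and> Q \<subseteq> P" if "primeideal P T" for P
    using primeideal_trivial_extension least[OF that] least
    by (rule least_prime_imp_unique_minimal_prime)
  then show ?thesis
    using cring_trivial_extension by (simp add: mp_ring_def)
qed

lemma not_mid_ring_trivial_extension: "\<not> mid_ring T"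
proof
  assume mid: "mid_ring T"
  interpret P: primeideal "{k. k div 2 = 0}" T by (rule primeideal_trivial_extension)
  have "4 \<otimes> 1 = \<zero>"
    by (rule int_eq_div_2_even) (auto simp: trivial_extension_simps)
  then have "4 \<in> annihilator T 1"
    by (simp add: annihilator_def trivial_extension_simps)
  then obtain b where b: "b \<in> annihilator T 1" and "4 \<otimes> (\<one> \<ominus> b) \<in> nilradical T"
    using mid unfolding mid_ring_def N_pure_def by (metis UNIV_I trivial_extension_simps(1))
  then have "(\<one> \<ominus> b) div 2 = 0"
    using P.nilradical_subset P.I_prime[of 4 "\<one> \<ominus> b"] by (auto simp: trivial_extension_simps(1))
  then have "b div 2 = (b \<oplus> (\<one> \<ominus> b)) div 2"
    by (auto simp: trivial_extension_simps(4))
  also have "b \<oplus> (\<one> \<ominus> b) = 2"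
    by (simp add: P.add_minus_cancel trivial_extension_simps(1,2))
  finally have "b div 2 = 1"
    by simp
  moreover have "even (b \<otimes> 1)"
    using b by (simp add: annihilator_def trivial_extension_simps(3))
  ultimately show False
    by (simp add: trivial_extension_simps)
qed

end

theorem mainTheorem10:
  shows "(\<forall>R :: ('a, 'm) ring_scheme. reduced_ring R \<and> mp_ring R \<longrightarrow> mid_ring R)
    \<and> (\<exists>R :: int ring. mid_ring R \<and> \<not> (reduced_ring R \<and> mp_ring R))
    \<and> (\<forall>R :: ('a, 'm) ring_scheme. mid_ring R \<longrightarrow> mp_ring R)
    \<and> (\<exists>R :: int ring. mp_ring R \<and> \<not> mid_ring R)"
  using reduced_mp_ring_imp_mid_ring mid_ring_residue_ring_4 not_reduced_residue_ring_4
    mid_ring_imp_mp_ring mp_ring_trivial_extension not_mid_ring_trivial_extension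
  by blast

end
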